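(* Let $G=(V,E)$ be an infinite connected graph of bounded degree. If $H_n^*=O(n^\alpha)$ and $\mathrm{TV}_n=O(n^{-\beta})$ as $n\to\infty$ for some $\alpha,\beta\in(0,1]$, then the isoperimetric profile $\Phi$ of $G$ satisfies \[ \Phi(n)=O\left(\left(\frac{\log\log n}{\log n}\right)^{\beta/\alpha}\right)\qquad\text{as } n\to\infty. \]
   Context: The lazy simple random walk on $G$ stays in place with probability $1/2$ at each step and otherwise moves along a uniformly random edge at the current vertex; $P^n$ is its $n$-step transition matrix. Define \[ \mathrm{TV}_n:=\sup_{x\sim y}\frac12\sum_{z\in V}|P^n(x,z)-P^n(y,z)|,\qquad H_n^*:=\sup_{x\in V}\max_{0\le m\le n}\sum_{y}P^m(x,y)\bigl(-\log P^m(x,y)\bigr), \] where the first supremum is over pairs of neighbouring vertices and $0\log0=0$. For $W\subseteq V$, $\partial W$ is the set of edges with one endpoint in $W$ and the other not in $W$. The isoperimetric profile of $G$ is \[ \Phi(n):=\inf\left\{\frac{|\partial W|}{\sum_{w\in W}\deg(w)} : W\subseteq V \text{ finite, non-empty, } \sum_{w\in W}\deg(w)\le n\right\}. \] *)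

theory Defs
  imports "HOL-Probability.Probability" "HOL-Library.Landau_Symbols"
begin

text \<open>
  A (simple, undirected, possibly infinite) graph is given by a vertex set \<open>V\<close> and a set \<open>E\<close> of
  two-element subsets of \<open>V\<close>.
\<close>

definition simple_graph :: "'a set \<Rightarrow> 'a set set \<Rightarrow> bool" where
  "simple_graph V E \<longleftrightarrow> (\<forall>e\<in>E. e \<subseteq> V \<and> card e = 2)"

definition adjacent :: "'a set set \<Rightarrow> 'a \<Rightarrow> 'a \<Rightarrow> bool" where
  "adjacent E x y \<longleftrightarrow> {x, y} \<in> E"

definition graph_connected :: "'a set \<Rightarrow> 'a set set \<Rightarrow> bool" where
  "graph_connected V E \<longleftrightarrow> V \<noteq> {} \<and> (\<forall>x\<in>V. \<forall>y\<in>V. (adjacent E)\<^sup>*\<^sup>* x y)"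

definition incident_edges :: "'a set set \<Rightarrow> 'a \<Rightarrow> 'a set set" where
  "incident_edges E x = {e \<in> E. x \<in> e}"

definition vertex_degree :: "'a set set \<Rightarrow> 'a \<Rightarrow> nat" where
  "vertex_degree E x = card (incident_edges E x)"

text \<open>Finiteness is required explicitly because the cardinality of an infinite set is \<open>0\<close>.\<close>

definition bounded_degree :: "'a set \<Rightarrow> 'a set set \<Rightarrow> bool" where
  "bounded_degree V E \<longleftrightarrow> (\<exists>D. \<forall>x\<in>V. finite (incident_edges E x) \<and> vertex_degree E x \<le> D)"

text \<open>
  One step of the lazy walk from \<open>x\<close>; the endpoint of an edge \<open>e\<close> at \<open>x\<close> other than \<open>x\<close> is the
  unique element of \<open>e - {x}\<close>. The uniform distribution is only meaningful if \<open>incident_edges E x\<close>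
  is finite and non-empty, which holds at every vertex of an infinite connected graph of bounded
  degree.
\<close>

definition lazy_step :: "'a set set \<Rightarrow> 'a \<Rightarrow> 'a pmf" where
  "lazy_step E x =
     bind_pmf (bernoulli_pmf (1/2)) (\<lambda>stay.
       if stay then return_pmf x
       else map_pmf (\<lambda>e. the_elem (e - {x})) (pmf_of_set (incident_edges E x)))"

primrec lazy_walk :: "'a set set \<Rightarrow> nat \<Rightarrow> 'a \<Rightarrow> 'a pmf" where
  "lazy_walk E 0 x = return_pmf x"
| "lazy_walk E (Suc n) x = bind_pmf (lazy_walk E n x) (lazy_step E)"

definition transition :: "'a set set \<Rightarrow> nat \<Rightarrow> 'a \<Rightarrow> 'a \<Rightarrow> real" where
  "transition E n x y = pmf (lazy_walk E n x) y"

text \<open>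
  On an infinite connected graph of bounded degree both suprema below are over non-empty bounded
  sets of reals, and every infinite sum has only finitely many non-zero terms. The convention
  \<open>0 log 0 = 0\<close> is automatic, as the factor \<open>0\<close> makes the product \<open>0\<close>.
\<close>

definition TV :: "'a set \<Rightarrow> 'a set set \<Rightarrow> nat \<Rightarrow> real" where
  "TV V E n =
     (SUP (x, y) \<in> {(x, y). x \<in> V \<and> y \<in> V \<and> adjacent E x y}.
        1/2 * (\<Sum>\<^sub>\<infinity>z\<in>V. \<bar>transition E n x z - transition E n y z\<bar>))"

definition max_entropy :: "'a set \<Rightarrow> 'a set set \<Rightarrow> nat \<Rightarrow> real" where
  "max_entropy V E n =
     (SUP x\<in>V. MAX m\<in>{0..n}. \<Sum>\<^sub>\<infinity>y\<in>V. transition E m x y * (- ln (transition E m x y)))"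

definition edge_boundary :: "'a set set \<Rightarrow> 'a set \<Rightarrow> 'a set set" where
  "edge_boundary E W = {e \<in> E. \<exists>x y. e = {x, y} \<and> x \<in> W \<and> y \<notin> W}"

text \<open>
  For \<open>n\<close> below the minimal degree the infimum is over the empty set, and its value there is
  arbitrary; this affects only finitely many \<open>n\<close>.
\<close>

definition isoperimetric_profile :: "'a set \<Rightarrow> 'a set set \<Rightarrow> nat \<Rightarrow> real" where
  "isoperimetric_profile V E n =
     Inf {real (card (edge_boundary E W)) / real (\<Sum>w\<in>W. vertex_degree E w) | W.
            W \<subseteq> V \<and> finite W \<and> W \<noteq> {} \<and> (\<Sum>w\<in>W. vertex_degree E w) \<le> n}"

end

theory Submission
  imports Defs
begin

text \<open>
  Fix \<open>m\<close>, let \<open>h\<close> bound the entropies of \<open>P\<^sup>m(x, \<cdot>)\<close>, and put \<open>t = exp (-2h) / 2\<close>. By Markov's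
  inequality \<open>\<xi>\<^sub>x = (P\<^sup>m(x, \<cdot>) - t)\<^sup>+\<close> has mass at least \<open>1/4\<close>; truncation is \<open>1\<close>-Lipschitz, so
  \<open>\<xi>\<^sub>x\<close> and \<open>\<xi>\<^sub>y\<close> differ by at most \<open>2 TV\<^sub>m\<close> in \<open>l\<^sup>1\<close> for \<open>x \<sim> y\<close>; and by reversibility
  \<open>{x. \<xi>\<^sub>x(z) > 0}\<close> has volume at most \<open>deg z / t\<close>. For an arbitrary finite set \<open>W\<close>, summing the
  \<open>L\<^sup>1\<close> isoperimetric inequality for the functions \<open>x \<mapsto> 1\<^sub>W(x) \<xi>\<^sub>x(z)\<close> over \<open>z\<close> shows that an
  isoperimetric constant \<open>\<phi> > 8 TV\<^sub>m\<close> for sets of volume at most \<open>D / t\<close> would force a positive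
  isoperimetric constant for all finite sets. Such a nonamenable graph has
  linearly growing entropy by Cheeger's inequality, whereas the chain rule bounds the entropy at time
  \<open>n\<close> by a multiple of \<open>TV\<^sub>0 + \<dots> + TV\<^sub>n\<^sub>-\<^sub>1 = o(n)\<close>. Hence \<open>\<Phi>(2D exp (2h)) \<le> 8 TV\<^sub>m\<close>; now take \<open>m\<close> of
  order \<open>(log n)\<^bsup>1/\<alpha>\<^esup>\<close>. This even gives the rate without the factor \<open>log log n\<close>.
\<close>

section \<open>Mass surviving truncation under an entropy bound\<close>

text \<open>Markov's inequality in pointwise form: \<open>p / 2 - p * (- ln p) / (4 * h)\<close> is
  at most the truncation of \<open>p\<close>. Where \<open>p\<close> is at least twice the level,
  truncation keeps half of it; elsewhere \<open>p = 0\<close> or \<open>- ln p \<ge> 2 * h\<close>,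
  and the left side is at most 0. Summation leaves \<open>1/2 - 1/4\<close>.\<close>

lemma quarter_le_sum_truncated:
  fixes p :: "'b \<Rightarrow> real"
  assumes p: "\<And>z. z \<in> S \<Longrightarrow> 0 \<le> p z" "\<And>z. z \<in> S \<Longrightarrow> p z \<le> 1"
    and sum_p: "(\<Sum>z\<in>S. p z) = 1"
    and entropy: "(\<Sum>z\<in>S. p z * (- ln (p z))) \<le> h" and h: "h > 0"
  shows "1/4 \<le> (\<Sum>z\<in>S. max 0 (p z - exp (- (2 * h)) / 2))"
proof -
  let ?t = "exp (- (2 * h)) / 2 :: real"
  have "p z / 2 - (1 / (4 * h)) * (p z * (- ln (p z))) \<le> max 0 (p z - ?t)" if z: "z \<in> S" for z
  proof (cases "p z \<ge> 2 * ?t")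
    case True
    then have pos: "p z > 0" using exp_gt_zero[of "- (2 * h)"] by linarith
    have "ln (p z) \<le> 0" using p(2)[OF z] pos by simp
    then have "p z * (- ln (p z)) \<ge> 0" using pos by (intro mult_nonneg_nonneg) auto
    then have "(1 / (4 * h)) * (p z * (- ln (p z))) \<ge> 0" using h by (intro mult_nonneg_nonneg[of "1 / (4 * h)"]) auto
    then show ?thesis using True by simp
  next
    case False
    show ?thesis
    proof (cases "p z = 0")
      case False
      then have pos: "p z > 0" using p[OF z] by simp
      have "p z < exp (- (2 * h))" using \<open>\<not> p z \<ge> 2 * ?t\<close> by simp
      then have "ln (p z) < ln (exp (- (2 * h)))" using pos by (subst ln_less_cancel_iff) auto
      then have "2 * h \<le> - ln (p z)" by simp
      then have "p z * (2 * h) \<le> p z * (- ln (p z))" using pos by (intro mult_left_mono) auto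
      then have "p z / 2 \<le> (1 / (4 * h)) * (p z * (- ln (p z)))"
        using h by (simp add: field_simps)
      then show ?thesis by simp
    qed simp
  qed
  then have "(\<Sum>z\<in>S. p z / 2 - (1 / (4 * h)) * (p z * (- ln (p z)))) \<le> (\<Sum>z\<in>S. max 0 (p z - ?t))"
    by (rule sum_mono)
  moreover have "(\<Sum>z\<in>S. p z / 2 - (1 / (4 * h)) * (p z * (- ln (p z)))) =
      1/2 - (1 / (4 * h)) * (\<Sum>z\<in>S. p z * (- ln (p z)))"
    by (simp only: sum_subtractf sum_distrib_left sum_p flip: sum_divide_distrib)
  moreover have "(1 / (4 * h)) * (\<Sum>z\<in>S. p z * (- ln (p z))) \<le> (1 / (4 * h)) * h"
    by (rule mult_left_mono[OF entropy]) (use h in auto)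
  moreover have "(1 / (4 * h)) * h = 1/4" using h by simp
  ultimately show ?thesis by linarith
qed

section \<open>Neighbours, one-step formulas and reversibility of the walk\<close>

definition nbrs :: "'a set set \<Rightarrow> 'a \<Rightarrow> 'a set" where
  "nbrs E x = {y. adjacent E x y}"

lemma nbrs_sym: "y \<in> nbrs E x \<longleftrightarrow> x \<in> nbrs E y"
  by (simp add: nbrs_def adjacent_def insert_commute)

locale bounded_degree_graph =
  fixes V :: "'a set" and E :: "'a set set" and D :: nat
  assumes simple: "simple_graph V E"
    and infinite_V: "infinite V"
    and connected: "graph_connected V E"
    and finite_incident: "x \<in> V \<Longrightarrow> finite (incident_edges E x)"
    and degree_le: "x \<in> V \<Longrightarrow> vertex_degree E x \<le> D"
begin

abbreviation deg :: "'a \<Rightarrow> nat" where "deg \<equiv> vertex_degree E"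
abbreviation P :: "nat \<Rightarrow> 'a \<Rightarrow> 'a \<Rightarrow> real" where "P \<equiv> transition E"
abbreviation support :: "nat \<Rightarrow> 'a \<Rightarrow> 'a set" where "support n x \<equiv> set_pmf (lazy_walk E n x)"

lemma nbrsD:
  assumes "y \<in> nbrs E x"
  shows "x \<in> V" "y \<in> V" "x \<noteq> y"
  using assms simple by (auto simp: nbrs_def adjacent_def simple_graph_def)

lemma nbrs_irrefl [simp]: "x \<notin> nbrs E x"
  using nbrsD(3) by blast

lemma bij_betw_nbrs: "bij_betw (\<lambda>y. {x, y}) (nbrs E x) (incident_edges E x)"
proof (rule bij_betw_imageI)
  show "inj_on (\<lambda>y. {x, y}) (nbrs E x)"
    by (auto simp: inj_on_def doubleton_eq_iff)
  show "(\<lambda>y. {x, y}) ` nbrs E x = incident_edges E x"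
  proof (intro equalityI subsetI)
    fix e assume e: "e \<in> incident_edges E x"
    then have "card e = 2" "x \<in> e" using simple by (auto simp: simple_graph_def incident_edges_def)
    then obtain y where "e = {x, y}" by (auto simp: card_2_iff)
    then show "e \<in> (\<lambda>y. {x, y}) ` nbrs E x"
      using e by (auto simp: nbrs_def adjacent_def incident_edges_def)
  qed (auto simp: nbrs_def adjacent_def incident_edges_def)
qed

lemma card_nbrs: "card (nbrs E x) = deg x"
  using bij_betw_same_card[OF bij_betw_nbrs] by (simp add: vertex_degree_def)

lemma finite_nbrs: "x \<in> V \<Longrightarrow> finite (nbrs E x)"
  using bij_betw_finite[OF bij_betw_nbrs] finite_incident by blast

lemma nbrs_nonempty:
  assumes "x \<in> V" shows "nbrs E x \<noteq> {}"
proof -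
  obtain y where y: "y \<in> V" "y \<noteq> x"
    using infinite_V by (metis finite.emptyI finite_insert insertCI finite_subset subsetI)
  have "(adjacent E)\<^sup>*\<^sup>* x y" using connected assms y by (auto simp: graph_connected_def)
  then show ?thesis using y
    by (cases rule: converse_rtranclpE) (auto simp: nbrs_def)
qed

lemma deg_pos: "x \<in> V \<Longrightarrow> deg x > 0"
  using nbrs_nonempty[of x] finite_nbrs[of x] card_nbrs[of x] by (metis card_gt_0_iff)

lemma V_nonempty: "V \<noteq> {}"
  using infinite_V by auto

lemma D_pos: "D > 0"
  using V_nonempty deg_pos degree_le by fastforce

text \<open>The walk is defined through incident edges, while all computations run over neighbours.
  The map \<open>y \<mapsto> {x, y}\<close> is a bijection between the two, and removing
  \<open>x\<close> from the edge undoes it.\<close>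

lemma lazy_step_eq:
  assumes "x \<in> V"
  shows "lazy_step E x = bind_pmf (bernoulli_pmf (1/2))
           (\<lambda>stay. if stay then return_pmf x else pmf_of_set (nbrs E x))"
proof -
  have img: "(\<lambda>y. {x, y}) ` nbrs E x = incident_edges E x" and
      inj: "inj_on (\<lambda>y. {x, y}) (nbrs E x)"
    using bij_betw_nbrs[of x] by (auto simp: bij_betw_def)
  have "pmf_of_set (incident_edges E x) = map_pmf (\<lambda>y. {x, y}) (pmf_of_set (nbrs E x))"
    using map_pmf_of_set_inj[OF inj nbrs_nonempty[OF assms] finite_nbrs[OF assms]] img by simp
  then have "map_pmf (\<lambda>e. the_elem (e - {x})) (pmf_of_set (incident_edges E x)) =
      map_pmf (\<lambda>y. the_elem ({x, y} - {x})) (pmf_of_set (nbrs E x))"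
    by (simp add: pmf.map_comp o_def)
  also have "\<dots> = map_pmf (\<lambda>y. y) (pmf_of_set (nbrs E x))"
  proof (rule map_pmf_cong[OF refl])
    fix y assume "y \<in> set_pmf (pmf_of_set (nbrs E x))"
    then have "y \<noteq> x" using nbrsD nbrs_nonempty[OF assms] finite_nbrs[OF assms] by auto
    then have "{x, y} - {x} = {y}" by auto
    then show "the_elem ({x, y} - {x}) = y" by simp
  qed
  finally show ?thesis by (simp add: lazy_step_def cong: if_cong)
qed

lemma pmf_lazy_step:
  assumes "x \<in> V"
  shows "pmf (lazy_step E x) y =
    (if y = x then 1/2 else 0) + (if y \<in> nbrs E x then 1 / (2 * deg x) else 0)"
  using nbrs_nonempty[OF assms] finite_nbrs[OF assms]
  by (auto simp: lazy_step_eq[OF assms] pmf_bind card_nbrs indicator_def)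

lemma set_lazy_step:
  assumes "x \<in> V" shows "set_pmf (lazy_step E x) = insert x (nbrs E x)"
  using deg_pos[OF assms]
  by (auto simp: set_pmf_iff pmf_lazy_step[OF assms] add_nonneg_eq_0_iff split: if_splits)

lemma support_Suc_right:
  assumes "support n x \<subseteq> V"
  shows "support (Suc n) x = (\<Union>y\<in>support n x. insert y (nbrs E y))"
  using assms by (auto simp: set_lazy_step subset_iff)

lemma support_subset:
  assumes "x \<in> V" shows "support n x \<subseteq> V"
proof (induction n)
  case (Suc n)
  then show ?case
    unfolding support_Suc_right[OF Suc] by (auto dest: nbrsD(2))
qed (use assms in auto)

lemma finite_support:
  assumes "x \<in> V" shows "finite (support n x)"
proof (induction n)
  case (Suc n)
  have "support n x \<subseteq> V" using assms by (rule support_subset)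
  then show ?case
    unfolding support_Suc_right[OF \<open>support n x \<subseteq> V\<close>] using Suc finite_nbrs by auto
qed auto

text \<open>The definition appends a step; prepending one instead exhibits the law at time
  \<open>Suc n\<close> as a mixture of the laws at time \<open>n\<close> from \<open>x\<close> and
  its neighbours. The entropy recursion and the energy decay rest on this form.\<close>

lemma lazy_walk_Suc_left: "lazy_walk E (Suc n) x = bind_pmf (lazy_step E x) (lazy_walk E n)"
proof (induction n)
  case (Suc n)
  have "lazy_walk E (Suc (Suc n)) x =
      bind_pmf (bind_pmf (lazy_step E x) (lazy_walk E n)) (lazy_step E)"
    unfolding lazy_walk.simps(2)[of E "Suc n" x] Suc ..
  also have "\<dots> = bind_pmf (lazy_step E x) (\<lambda>y. bind_pmf (lazy_walk E n y) (lazy_step E))"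
    by (rule bind_assoc_pmf)
  finally show ?case by simp
qed (simp add: bind_return_pmf bind_return_pmf')

lemma support_Suc:
  assumes "x \<in> V" shows "support (Suc n) x = support n x \<union> (\<Union>y\<in>nbrs E x. support n y)"
  unfolding lazy_walk_Suc_left set_bind_pmf set_lazy_step[OF assms] by simp

lemma P_nonneg: "P n x y \<ge> 0"
  by (simp add: transition_def)

lemma P_le_1: "P n x y \<le> 1"
  by (simp add: transition_def pmf_le_1)

lemma P_eq_0: "y \<notin> support n x \<Longrightarrow> P n x y = 0"
  by (simp add: transition_def set_pmf_iff)

lemma P_pos: "y \<in> support n x \<Longrightarrow> P n x y > 0"
  by (simp add: transition_def pmf_positive)

lemma sum_P:
  assumes "finite F" "support n x \<subseteq> F" shows "(\<Sum>y\<in>F. P n x y) = 1"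
  unfolding transition_def using assms by (rule sum_pmf_eq_1)

lemma P_Suc_left:
  assumes "x \<in> V"
  shows "P (Suc n) x z = P n x z / 2 + (\<Sum>y\<in>nbrs E x. P n y z) / (2 * deg x)"
proof -
  have "P (Suc n) x z = (\<Sum>y\<in>insert x (nbrs E x). pmf (lazy_walk E n y) z * pmf (lazy_step E x) y)"
    unfolding transition_def lazy_walk_Suc_left pmf_bind
    by (rule integral_measure_pmf_real) (auto simp: finite_nbrs set_lazy_step assms)
  also have "\<dots> = P n x z / 2 + (\<Sum>y\<in>nbrs E x. pmf (lazy_walk E n y) z * pmf (lazy_step E x) y)"
    using finite_nbrs[OF assms]
    by (subst sum.insert) (auto simp: pmf_lazy_step[OF assms] transition_def)
  also have "(\<Sum>y\<in>nbrs E x. pmf (lazy_walk E n y) z * pmf (lazy_step E x) y) =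
      (\<Sum>y\<in>nbrs E x. P n y z * (1 / (2 * deg x)))"
    by (rule sum.cong[OF refl])
      (use nbrsD(3) in \<open>force simp: pmf_lazy_step[OF assms] transition_def\<close>)
  finally show ?thesis by (simp flip: sum_divide_distrib)
qed

lemma P_Suc_right:
  assumes "x \<in> V" "z \<in> V"
  shows "P (Suc n) x z = P n x z / 2 + (\<Sum>y\<in>nbrs E z. P n x y / (2 * deg y))"
proof -
  let ?F = "support n x \<union> insert z (nbrs E z)"
  have fin: "finite ?F" using assms finite_nbrs finite_support by auto
  have FV: "?F \<subseteq> V" using assms support_subset[OF assms(1)] nbrsD by auto
  have "P (Suc n) x z = (\<Sum>y\<in>?F. pmf (lazy_step E y) z * P n x y)"
    unfolding transition_def lazy_walk.simps pmf_bind
    by (rule integral_measure_pmf_real) (use fin in auto)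
  also have "\<dots> = (\<Sum>y\<in>?F. (if y = z then P n x y / 2 else 0) +
                      (if y \<in> nbrs E z then P n x y / (2 * deg y) else 0))"
  proof (rule sum.cong[OF refl])
    fix y assume "y \<in> ?F"
    then have "y \<in> V" using FV by auto
    then show "pmf (lazy_step E y) z * P n x y = (if y = z then P n x y / 2 else 0) +
                      (if y \<in> nbrs E z then P n x y / (2 * deg y) else 0)"
      using nbrs_sym[of z E y] by (auto simp: pmf_lazy_step)
  qed
  also have "\<dots> = (\<Sum>y\<in>?F. if y = z then P n x y / 2 else 0) +
                      (\<Sum>y\<in>?F. if y \<in> nbrs E z then P n x y / (2 * deg y) else 0)"
    by (rule sum.distrib)
  also have "(\<Sum>y\<in>?F. if y = z then P n x y / 2 else 0) = P n x z / 2"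
    using fin by (subst sum.delta) auto
  also have "(\<Sum>y\<in>?F. if y \<in> nbrs E z then P n x y / (2 * deg y) else 0) =
      (\<Sum>y\<in>nbrs E z. P n x y / (2 * deg y))"
    by (rule sum.mono_neutral_cong_right) (use fin in auto)
  finally show ?thesis .
qed

text \<open>Detailed balance survives the induction because the last step of the walk from
  \<open>x\<close> can be read as the first step of the walk from \<open>z\<close>; the factor
  \<open>1 / deg y\<close> of that step is what the balance between \<open>x\<close> and
  \<open>y\<close> cancels.\<close>

lemma reversible:
  assumes "x \<in> V" "z \<in> V"
  shows "deg x * P n x z = deg z * P n z x"
  using assms
proof (induction n arbitrary: x z)
  case 0
  then show ?case by (simp add: transition_def indicator_def)
next
  case (Suc n)
  note xz = Suc.prems
  have "deg x * P (Suc n) x z = deg x * P n x z / 2 + (\<Sum>y\<in>nbrs E z. deg x * P n x y / (2 * deg y))"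
    by (simp add: P_Suc_right[OF xz] distrib_left sum_distrib_left)
  also have "(\<Sum>y\<in>nbrs E z. deg x * P n x y / (2 * deg y)) = (\<Sum>y\<in>nbrs E z. P n y x / 2)"
  proof (rule sum.cong[OF refl])
    fix y assume "y \<in> nbrs E z"
    then have y: "y \<in> V" by (rule nbrsD(2))
    show "deg x * P n x y / (2 * deg y) = P n y x / 2"
      unfolding Suc.IH[OF xz(1) y] using deg_pos[OF y] by simp
  qed
  also have "\<dots> = (\<Sum>y\<in>nbrs E z. P n y x) / 2"
    by (rule sum_divide_distrib[symmetric])
  also have "deg x * P n x z = deg z * P n z x"
    by (rule Suc.IH[OF xz])
  also have "deg z * P n z x / 2 + (\<Sum>y\<in>nbrs E z. P n y x) / 2 = deg z * P (Suc n) z x"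
    using deg_pos[OF xz(2)] by (simp add: P_Suc_left[OF xz(2)] distrib_left)
  finally show ?case .
qed

section \<open>Volume, edge boundary, coarea inequality and localization\<close>

definition vol :: "'a set \<Rightarrow> nat" where "vol U = (\<Sum>x\<in>U. deg x)"
text \<open>Each boundary edge is attributed to its inner endpoint, so that it is counted once and
  the count splits into a sum over vertices.\<close>

definition bd :: "'a set \<Rightarrow> nat" where "bd U = (\<Sum>x\<in>U. card (nbrs E x - U))"

lemma card_edge_boundary:
  assumes "finite W" "W \<subseteq> V"
  shows "card (edge_boundary E W) = bd W"
proof -
  have "bij_betw (\<lambda>(x, y). {x, y}) (SIGMA x:W. nbrs E x - W) (edge_boundary E W)"
  proof (rule bij_betw_imageI)
    show "inj_on (\<lambda>(x, y). {x, y}) (SIGMA x:W. nbrs E x - W)"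
      by (auto simp: inj_on_def doubleton_eq_iff)
    show "(\<lambda>(x, y). {x, y}) ` (SIGMA x:W. nbrs E x - W) = edge_boundary E W"
      by (auto simp: edge_boundary_def nbrs_def adjacent_def image_iff Bex_def)
  qed
  then have "card (edge_boundary E W) = card (SIGMA x:W. nbrs E x - W)"
    by (rule bij_betw_same_card[symmetric])
  then show ?thesis
    using assms finite_nbrs by (simp add: bd_def card_SigmaI subset_iff)
qed

lemma vol_pos: "finite W \<Longrightarrow> W \<subseteq> V \<Longrightarrow> W \<noteq> {} \<Longrightarrow> vol W > 0"
  unfolding vol_def by (rule sum_pos) (auto simp del: neq0_conv intro!: deg_pos)

text \<open>Layer cake, by induction on the number of points where \<open>f\<close> is positive.
  Lowering \<open>f\<close> on its positivity set \<open>B\<close> by its least value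
  \<open>s\<close> there reduces the weighted sum by \<open>s * vol B\<close> and the gradient sum
  by \<open>s * bd B\<close>. Isoperimetry is asked only of sets on which \<open>f\<close> is
  positive, and \<open>localization\<close> depends on this.\<close>

lemma coarea:
  fixes f :: "'a \<Rightarrow> real" and \<phi> :: real
  assumes A: "finite A" "A \<subseteq> V"
    and "\<And>x. f x \<ge> 0" "\<And>x. x \<notin> A \<Longrightarrow> f x = 0"
    and "\<And>U. U \<subseteq> A \<Longrightarrow> U \<noteq> {} \<Longrightarrow> (\<And>x. x \<in> U \<Longrightarrow> f x > 0) \<Longrightarrow> \<phi> * vol U \<le> bd U"
  shows "\<phi> * (\<Sum>x\<in>A. deg x * f x) \<le> (\<Sum>x\<in>A. \<Sum>y\<in>nbrs E x. max 0 (f x - f y))"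
  using assms(3-)
proof (induction "card {x\<in>A. f x > 0}" arbitrary: f rule: less_induct)
  case (less f)
  note f_nonneg = less.prems(1) and f_zero = less.prems(2) and iso = less.prems(3)
  define B where "B = {x\<in>A. f x > 0}"
  have finB: "finite B" and BA: "B \<subseteq> A" using A by (auto simp: B_def)
  have f_B: "f x = 0" if "x \<notin> B" for x
    using that f_nonneg[of x] f_zero[of x] by (force simp: B_def)
  show ?case
  proof (cases "B = {}")
    case True
    then have "f x = 0" for x using f_B by auto
    then show ?thesis by simp
  next
    case False
    define s where "s = Min (f ` B)"
    have "s \<in> f ` B" unfolding s_def using False finB by (intro Min_in) auto
    then obtain b where b: "b \<in> B" "f b = s" by auto
    have s_pos: "s > 0" using b by (auto simp: B_def)
    have s_le: "s \<le> f x" if "x \<in> B" for x using that finB by (auto simp: s_def)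
    define g where "g x = (if x \<in> B then f x - s else 0)" for x
    \<comment> \<open>The minimum is attained at \<open>b\<close>, where \<open>g\<close> vanishes,
      so the positivity set shrinks strictly.\<close>
    have "{x\<in>A. g x > 0} \<subset> B" using b by (auto simp: g_def split: if_splits)
    then have card: "card {x\<in>A. g x > 0} < card {x\<in>A. f x > 0}"
      using psubset_card_mono[OF finB] by (simp add: B_def)
    have IH: "\<phi> * (\<Sum>x\<in>A. deg x * g x) \<le> (\<Sum>x\<in>A. \<Sum>y\<in>nbrs E x. max 0 (g x - g y))"
    proof (rule less.hyps[OF card])
      show "g x \<ge> 0" for x using s_le by (auto simp: g_def)
      show "g x = 0" if "x \<notin> A" for x using that BA by (auto simp: g_def)
      show "\<phi> * vol U \<le> bd U" if "U \<subseteq> A" "U \<noteq> {}" "\<And>x. x \<in> U \<Longrightarrow> g x > 0" for U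
        using that(1,2)
      proof (rule iso)
        fix x assume "x \<in> U"
        from that(3)[OF this] show "f x > 0" by (auto simp: g_def B_def split: if_splits)
      qed
    qed
    have "(\<Sum>x\<in>A. deg x * f x) = (\<Sum>x\<in>A. deg x * g x + (if x \<in> B then deg x * s else 0))"
      by (rule sum.cong[OF refl]) (use f_B in \<open>auto simp: g_def right_diff_distrib\<close>)
    also have "\<dots> = (\<Sum>x\<in>A. deg x * g x) + (\<Sum>x\<in>B. deg x * s)"
      using A BA by (simp add: sum.distrib sum.If_cases Int_absorb1)
    also have "(\<Sum>x\<in>B. deg x * s) = s * vol B"
      by (simp add: vol_def sum_distrib_left mult.commute)
    finally have 1: "(\<Sum>x\<in>A. deg x * f x) = (\<Sum>x\<in>A. deg x * g x) + s * vol B" .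
    \<comment> \<open>For \<open>x\<close> in \<open>B\<close>, an edge inside \<open>B\<close>
      keeps its difference and an edge leaving \<open>B\<close> loses exactly \<open>s\<close>; for
      \<open>x\<close> outside \<open>B\<close> both gradient sums vanish.\<close>
    have "(\<Sum>y\<in>nbrs E x. max 0 (f x - f y)) =
        (\<Sum>y\<in>nbrs E x. max 0 (g x - g y)) + (if x \<in> B then s * card (nbrs E x - B) else 0)"
      if "x \<in> A" for x
    proof (cases "x \<in> B")
      case True
      have fin: "finite (nbrs E x)" using that A finite_nbrs by auto
      have "(\<Sum>y\<in>nbrs E x. max 0 (f x - f y)) =
          (\<Sum>y\<in>nbrs E x. max 0 (g x - g y) + (if y \<notin> B then s else 0))"
        by (rule sum.cong[OF refl])
          (use f_B s_le[OF True] s_pos True in \<open>auto simp: g_def max_def\<close>)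
      also have "\<dots> = (\<Sum>y\<in>nbrs E x. max 0 (g x - g y)) + s * card (nbrs E x - B)"
        using fin by (simp add: sum.distrib sum.If_cases Diff_eq Collect_neg_eq mult.commute)
      finally show ?thesis using True by simp
    next
      case False
      have g0: "g y \<ge> 0" for y using s_le by (auto simp: g_def)
      show ?thesis using False f_B[OF False] f_nonneg g0 by (simp add: g_def[of x])
    qed
    then have "(\<Sum>x\<in>A. \<Sum>y\<in>nbrs E x. max 0 (f x - f y)) =
        (\<Sum>x\<in>A. (\<Sum>y\<in>nbrs E x. max 0 (g x - g y)) + (if x \<in> B then s * card (nbrs E x - B) else 0))"
      by (rule sum.cong[OF refl])
    also have "\<dots> = (\<Sum>x\<in>A. \<Sum>y\<in>nbrs E x. max 0 (g x - g y)) + (\<Sum>x\<in>B. s * card (nbrs E x - B))"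
      using A BA by (simp add: sum.distrib sum.If_cases Int_absorb1)
    also have "(\<Sum>x\<in>B. s * card (nbrs E x - B)) = s * bd B"
      by (simp add: bd_def sum_distrib_left)
    finally have 2: "(\<Sum>x\<in>A. \<Sum>y\<in>nbrs E x. max 0 (f x - f y)) =
        (\<Sum>x\<in>A. \<Sum>y\<in>nbrs E x. max 0 (g x - g y)) + s * bd B" .
    have "\<phi> * vol B \<le> bd B" using False BA by (intro iso) (auto simp: B_def)
    then have "s * (\<phi> * vol B) \<le> s * bd B" using s_pos by simp
    then show ?thesis unfolding 1 2 using IH by (simp add: distrib_left mult.left_commute)
  qed
qed

text \<open>\<open>iso\<close> concerns only sets of volume at most \<open>D / t\<close>, while
  \<open>W\<close> is any finite set. The passage works because coarea for \<open>u z\<close> tests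
  only sets where \<open>P m x z > t\<close>, and these are small. After summation over
  \<open>z\<close> the left side is at least \<open>\<phi> / 4 * vol W\<close> by
  \<open>mass\<close>, the right side at most \<open>2 * \<epsilon> * vol W + bd W\<close>.\<close>

lemma localization:
  fixes \<phi> \<epsilon> t :: real
  assumes W: "finite W" "W \<subseteq> V" and \<phi>: "\<phi> \<ge> 0"
    and lip: "\<And>x y F. x \<in> V \<Longrightarrow> y \<in> nbrs E x \<Longrightarrow> finite F \<Longrightarrow> (\<Sum>z\<in>F. \<bar>P m x z - P m y z\<bar>) \<le> 2 * \<epsilon>"
    and mass: "\<And>x. x \<in> V \<Longrightarrow> 1/4 \<le> (\<Sum>z\<in>support m x. max 0 (P m x z - t))"
    and t: "t > 0"
    and iso: "\<And>U. finite U \<Longrightarrow> U \<subseteq> V \<Longrightarrow> U \<noteq> {} \<Longrightarrow> t * vol U \<le> D \<Longrightarrow> \<phi> * vol U \<le> bd U"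
  shows "(\<phi> / 4 - 2 * \<epsilon>) * vol W \<le> bd W"
proof -
  define F where "F = (\<Union>x\<in>W. support m x)"
  have finF: "finite F" using W finite_support by (auto simp: F_def)
  have FV: "F \<subseteq> V" using W support_subset by (auto simp: F_def)
  define u where "u z x = (if x \<in> W then max 0 (P m x z - t) else 0)" for z x
  have "\<phi> * (\<Sum>x\<in>W. deg x * u z x) \<le> (\<Sum>x\<in>W. \<Sum>y\<in>nbrs E x. max 0 (u z x - u z y))"
    if z: "z \<in> F" for z
  proof (rule coarea[OF W])
    show "u z x \<ge> 0" for x by (simp add: u_def)
    show "u z x = 0" if "x \<notin> W" for x using that by (simp add: u_def)
    fix U assume U: "U \<subseteq> W" "U \<noteq> {}" "\<And>x. x \<in> U \<Longrightarrow> u z x > 0"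
    have finU: "finite U" by (rule finite_subset[OF U(1) W(1)])
    have UV: "U \<subseteq> V" using U W by auto
    have zV: "z \<in> V" using z FV by auto
    \<comment> \<open>Reversibility turns the lower bound \<open>P m x z > t\<close> on
      \<open>U\<close> into a volume bound: the sum of \<open>deg x * P m x z\<close> is
      \<open>deg z\<close> times the probability that the walk from \<open>z\<close> is in
      \<open>U\<close>.\<close>
    have "t * vol U = (\<Sum>x\<in>U. deg x * t)" by (simp add: vol_def sum_distrib_left mult.commute)
    also have "\<dots> \<le> (\<Sum>x\<in>U. deg x * P m x z)"
      by (rule sum_mono, rule mult_left_mono) (use U(3) in \<open>force simp: u_def split: if_splits\<close>)+
    also have "\<dots> = (\<Sum>x\<in>U. deg z * P m z x)"
      by (rule sum.cong[OF refl], rule reversible) (use UV zV in auto)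
    also have "\<dots> = deg z * (\<Sum>x\<in>U. P m z x)" by (simp add: sum_distrib_left)
    also have "(\<Sum>x\<in>U. P m z x) \<le> (\<Sum>x\<in>U \<union> support m z. P m z x)"
      by (rule sum_mono2) (use finU finite_support[OF zV] P_nonneg in auto)
    also have "\<dots> = 1" by (rule sum_P) (use finU finite_support[OF zV] in auto)
    finally have "t * vol U \<le> deg z" by (simp add: mult_left_mono)
    also have "deg z \<le> D" by (rule degree_le[OF zV])
    finally show "\<phi> * vol U \<le> bd U" using iso[OF finU UV U(2)] by simp
  qed
  then have "(\<Sum>z\<in>F. \<phi> * (\<Sum>x\<in>W. deg x * u z x)) \<le>
      (\<Sum>z\<in>F. \<Sum>x\<in>W. \<Sum>y\<in>nbrs E x. max 0 (u z x - u z y))"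
    by (rule sum_mono)
  also have "\<dots> = (\<Sum>x\<in>W. \<Sum>y\<in>nbrs E x. \<Sum>z\<in>F. max 0 (u z x - u z y))"
    by (subst sum.swap, rule sum.cong[OF refl], rule sum.swap)
  also have "\<dots> \<le> (\<Sum>x\<in>W. \<Sum>y\<in>nbrs E x. 2 * \<epsilon> + (if y \<notin> W then 1 else 0))"
  proof (intro sum_mono)
    \<comment> \<open>Along an edge inside \<open>W\<close> the Lipschitz property of truncation
      gives \<open>2 * \<epsilon>\<close>; along an edge leaving \<open>W\<close> the value
      \<open>u z y\<close> is 0 and the total mass of \<open>P m x\<close> gives 1.\<close>
    fix x y assume x: "x \<in> W" and y: "y \<in> nbrs E x"
    have xV: "x \<in> V" using x W by auto
    have lip': "(\<Sum>z\<in>F. \<bar>P m x z - P m y z\<bar>) \<le> 2 * \<epsilon>" by (rule lip[OF xV y finF])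
    show "(\<Sum>z\<in>F. max 0 (u z x - u z y)) \<le> 2 * \<epsilon> + (if y \<notin> W then 1 else 0)"
    proof (cases "y \<in> W")
      case True
      have "(\<Sum>z\<in>F. max 0 (u z x - u z y)) \<le> (\<Sum>z\<in>F. \<bar>P m x z - P m y z\<bar>)"
        by (rule sum_mono) (use x True in \<open>auto simp: u_def\<close>)
      then show ?thesis using lip' True by simp
    next
      case False
      have "(\<Sum>z\<in>F. max 0 (u z x - u z y)) \<le> (\<Sum>z\<in>F. P m x z)"
        by (rule sum_mono) (use x False t P_nonneg[of m x] in \<open>auto simp: u_def\<close>)
      also have "\<dots> = 1" by (rule sum_P) (use finF x in \<open>auto simp: F_def\<close>)
      finally have "(\<Sum>z\<in>F. max 0 (u z x - u z y)) \<le> 1" .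
      \<comment> \<open>Together with \<open>lip'\<close> this yields
        \<open>\<epsilon> \<ge> 0\<close>.\<close>
      moreover have "0 \<le> (\<Sum>z\<in>F. \<bar>P m x z - P m y z\<bar>)" by (simp add: sum_nonneg)
      ultimately have "(\<Sum>z\<in>F. max 0 (u z x - u z y)) \<le> 2 * \<epsilon> + 1"
        using lip' by linarith
      then show ?thesis using False by simp
    qed
  qed
  also have "\<dots> = (\<Sum>x\<in>W. 2 * \<epsilon> * deg x + card (nbrs E x - W))"
  proof (rule sum.cong[OF refl])
    fix x assume "x \<in> W"
    then have "finite (nbrs E x)" using W finite_nbrs by auto
    then show "(\<Sum>y\<in>nbrs E x. 2 * \<epsilon> + (if y \<notin> W then 1 else 0)) = 2 * \<epsilon> * deg x + card (nbrs E x - W)"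
      by (simp add: sum.distrib sum.If_cases Diff_eq Collect_neg_eq card_nbrs)
  qed
  also have "\<dots> = 2 * \<epsilon> * vol W + bd W"
    by (simp add: sum.distrib vol_def bd_def sum_distrib_left)
  finally have upper: "(\<Sum>z\<in>F. \<phi> * (\<Sum>x\<in>W. deg x * u z x)) \<le> 2 * \<epsilon> * vol W + bd W" .
  have "(\<Sum>z\<in>F. \<phi> * (\<Sum>x\<in>W. deg x * u z x)) = \<phi> * (\<Sum>z\<in>F. \<Sum>x\<in>W. deg x * u z x)"
    by (rule sum_distrib_left[symmetric])
  also have "(\<Sum>z\<in>F. \<Sum>x\<in>W. deg x * u z x) = (\<Sum>x\<in>W. \<Sum>z\<in>F. deg x * u z x)"
    by (rule sum.swap)
  also have "\<dots> = (\<Sum>x\<in>W. deg x * (\<Sum>z\<in>F. u z x))" by (simp only: sum_distrib_left)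
  finally have lhs: "(\<Sum>z\<in>F. \<phi> * (\<Sum>x\<in>W. deg x * u z x)) = \<phi> * (\<Sum>x\<in>W. deg x * (\<Sum>z\<in>F. u z x))" .
  have "(1/4) * vol W = (\<Sum>x\<in>W. deg x * (1/4))"
    by (simp add: vol_def sum_distrib_left sum_divide_distrib)
  also have "\<dots> \<le> (\<Sum>x\<in>W. deg x * (\<Sum>z\<in>F. u z x))"
  proof (intro sum_mono mult_left_mono)
    fix x assume x: "x \<in> W"
    have "1/4 \<le> (\<Sum>z\<in>support m x. max 0 (P m x z - t))" using mass x W by auto
    also have "\<dots> \<le> (\<Sum>z\<in>F. max 0 (P m x z - t))"
      by (rule sum_mono2) (use finF x in \<open>auto simp: F_def\<close>)
    finally show "1/4 \<le> (\<Sum>z\<in>F. u z x)" using x by (simp add: u_def)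
  qed simp
  finally have "\<phi> * ((1/4) * vol W) \<le> \<phi> * (\<Sum>x\<in>W. deg x * (\<Sum>z\<in>F. u z x))"
    using \<phi> by (rule mult_left_mono)
  then show ?thesis using upper unfolding lhs by (simp add: algebra_simps)
qed

section \<open>Cheeger's inequality and exponential decay of the energy\<close>

lemma cheeger:
  fixes f :: "'a \<Rightarrow> real" and \<kappa> :: real
  assumes A: "finite A" "A \<subseteq> V"
    and f: "\<And>x. f x \<ge> 0" "\<And>x. x \<notin> A \<Longrightarrow> f x = 0"
    and \<kappa>: "\<kappa> > 0"
    and iso: "\<And>U. finite U \<Longrightarrow> U \<subseteq> V \<Longrightarrow> \<kappa> * vol U \<le> bd U"
  shows "\<kappa>\<^sup>2 / 4 * (\<Sum>x\<in>A. deg x * (f x)\<^sup>2) \<le> (\<Sum>x\<in>A. \<Sum>y\<in>nbrs E x. (max 0 (f x - f y))\<^sup>2)"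
proof -
  let ?N = "\<Sum>x\<in>A. deg x * (f x)\<^sup>2"
  let ?S = "\<Sum>x\<in>A. \<Sum>y\<in>nbrs E x. (max 0 (f x - f y))\<^sup>2"
  \<comment> \<open>Weighted AM-GM for \<open>2 * d * f x\<close>. The weights make the last term
    sum to half of \<open>\<kappa> * ?N\<close>, which can then be absorbed in the coarea inequality
    for the square of \<open>f\<close>.\<close>
  have pw: "max 0 ((f x)\<^sup>2 - (f y)\<^sup>2) \<le> 2 / \<kappa> * (max 0 (f x - f y))\<^sup>2 + \<kappa> / 2 * (f x)\<^sup>2" for x y
  proof (cases "f x > f y")
    case True
    define d where "d = f x - f y"
    have "(f x)\<^sup>2 - (f y)\<^sup>2 = d * (f x + f y)"
      by (simp add: d_def power2_eq_square algebra_simps)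
    also have "\<dots> \<le> d * (2 * f x)" using True by (intro mult_left_mono) (auto simp: d_def)
    also have "\<dots> \<le> d * (2 * f x) + \<kappa> / 2 * (f x - 2 * d / \<kappa>)\<^sup>2" using \<kappa> by simp
    also have "\<dots> = 2 / \<kappa> * d\<^sup>2 + \<kappa> / 2 * (f x)\<^sup>2"
      using \<kappa> by (simp add: power2_eq_square field_simps)
    finally have le: "(f x)\<^sup>2 - (f y)\<^sup>2 \<le> 2 / \<kappa> * d\<^sup>2 + \<kappa> / 2 * (f x)\<^sup>2" .
    have "0 \<le> 2 / \<kappa> * d\<^sup>2 + \<kappa> / 2 * (f x)\<^sup>2" using \<kappa> by simp
    then show ?thesis using le True by (simp add: d_def)
  next
    case False
    then have "(f x)\<^sup>2 \<le> (f y)\<^sup>2" using f(1) by (intro power_mono) auto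
    then show ?thesis using \<kappa> by simp
  qed
  have "\<kappa> * ?N \<le> (\<Sum>x\<in>A. \<Sum>y\<in>nbrs E x. max 0 ((f x)\<^sup>2 - (f y)\<^sup>2))"
  proof (rule coarea[OF A])
    fix U assume "U \<subseteq> A"
    then show "\<kappa> * vol U \<le> bd U" using A by (intro iso) (auto intro: finite_subset)
  qed (use f in auto)
  also have "\<dots> \<le> (\<Sum>x\<in>A. \<Sum>y\<in>nbrs E x. 2 / \<kappa> * (max 0 (f x - f y))\<^sup>2 + \<kappa> / 2 * (f x)\<^sup>2)"
    by (intro sum_mono pw)
  also have "\<dots> = 2 / \<kappa> * ?S + \<kappa> / 2 * ?N"
    by (simp add: sum.distrib card_nbrs sum_distrib_left mult.left_commute)
  finally have "\<kappa> / 2 * ?N \<le> 2 / \<kappa> * ?S" by simp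
  then have "\<kappa> / 2 * (\<kappa> / 2 * ?N) \<le> \<kappa> / 2 * (2 / \<kappa> * ?S)" using \<kappa> by (intro mult_left_mono) auto
  then show ?thesis using \<kappa> by (simp add: power2_eq_square)
qed

text \<open>Double counting of edges: since \<open>B\<close> contains all neighbours of
  \<open>A\<close>, each \<open>w\<close> in \<open>A\<close> is met \<open>deg w\<close>
  times.\<close>

lemma sum_nbrs_swap:
  fixes g :: "'a \<Rightarrow> real"
  assumes B: "finite B" "B \<subseteq> V" and AB: "A \<subseteq> B" "\<And>x. x \<in> A \<Longrightarrow> nbrs E x \<subseteq> B"
    and g: "\<And>x. x \<notin> A \<Longrightarrow> g x = 0"
  shows "(\<Sum>y\<in>B. \<Sum>w\<in>nbrs E y. g w) = (\<Sum>w\<in>A. deg w * g w)"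
proof -
  have finA: "finite A" by (rule finite_subset[OF AB(1) B(1)])
  have "(\<Sum>y\<in>B. \<Sum>w\<in>nbrs E y. g w) = (\<Sum>y\<in>B. \<Sum>w | w \<in> A \<and> w \<in> nbrs E y. g w)"
    by (intro sum.cong[OF refl] sum.mono_neutral_right) (use B g finite_nbrs in auto)
  also have "\<dots> = (\<Sum>w\<in>A. \<Sum>y | y \<in> B \<and> w \<in> nbrs E y. g w)"
    by (rule sum.swap_restrict[OF B(1) finA])
  also have "\<dots> = (\<Sum>w\<in>A. deg w * g w)"
  proof (rule sum.cong[OF refl])
    fix w assume "w \<in> A"
    then have "{y. y \<in> B \<and> w \<in> nbrs E y} = nbrs E w" using AB(2) nbrs_sym[of w E] by auto
    then show "(\<Sum>y | y \<in> B \<and> w \<in> nbrs E y. g w) = deg w * g w" by (simp add: card_nbrs)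
  qed
  finally show ?thesis .
qed

text \<open>The function being squared on the left is the lazy Markov operator applied to
  \<open>f\<close>. Laziness makes it the average of \<open>(f y + f w) / 2\<close> over the
  neighbours \<open>w\<close>, so Cauchy-Schwarz and the parallelogram identity leave the energy of
  \<open>f\<close> minus a quarter of the Dirichlet sum, which \<open>cheeger\<close> bounds from
  below.\<close>

lemma lazy_step_contraction:
  fixes f :: "'a \<Rightarrow> real" and \<kappa> :: real
  assumes B: "finite B" "B \<subseteq> V" and AB: "A \<subseteq> B" "\<And>x. x \<in> A \<Longrightarrow> nbrs E x \<subseteq> B"
    and f: "\<And>x. f x \<ge> 0" "\<And>x. x \<notin> A \<Longrightarrow> f x = 0"
    and \<kappa>: "\<kappa> > 0"
    and iso: "\<And>U. finite U \<Longrightarrow> U \<subseteq> V \<Longrightarrow> \<kappa> * vol U \<le> bd U"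
  shows "(\<Sum>y\<in>B. deg y * (f y / 2 + (\<Sum>w\<in>nbrs E y. f w) / (2 * deg y))\<^sup>2)
           \<le> (1 - \<kappa>\<^sup>2 / 16) * (\<Sum>y\<in>A. deg y * (f y)\<^sup>2)"
proof -
  let ?N = "\<Sum>y\<in>A. deg y * (f y)\<^sup>2"
  have finA: "finite A" by (rule finite_subset[OF AB(1) B(1)])
  have "(\<Sum>y\<in>B. deg y * (f y / 2 + (\<Sum>w\<in>nbrs E y. f w) / (2 * deg y))\<^sup>2) \<le>
      (\<Sum>y\<in>B. \<Sum>w\<in>nbrs E y. ((f y + f w) / 2)\<^sup>2)"
  proof (rule sum_mono)
    fix y assume "y \<in> B"
    then have d: "deg y > 0" using B deg_pos by blast
    have "f y / 2 + (\<Sum>w\<in>nbrs E y. f w) / (2 * deg y) = (\<Sum>w\<in>nbrs E y. (f y + f w) / 2) / deg y"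
      using d by (simp add: sum.distrib card_nbrs field_simps flip: sum_divide_distrib)
    then have "deg y * (f y / 2 + (\<Sum>w\<in>nbrs E y. f w) / (2 * deg y))\<^sup>2 =
        (\<Sum>w\<in>nbrs E y. (f y + f w) / 2)\<^sup>2 / deg y"
      using d by (simp add: power2_eq_square)
    also have "\<dots> \<le> ((\<Sum>w\<in>nbrs E y. ((f y + f w) / 2)\<^sup>2) * deg y) / deg y"
      using sum_squared_le_sum_of_squares[of "\<lambda>w. (f y + f w) / 2" "nbrs E y"] d
      by (intro divide_right_mono) (auto simp: card_nbrs)
    finally show "deg y * (f y / 2 + (\<Sum>w\<in>nbrs E y. f w) / (2 * deg y))\<^sup>2 \<le>
        (\<Sum>w\<in>nbrs E y. ((f y + f w) / 2)\<^sup>2)" using d by simp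
  qed
  also have "\<dots> = (\<Sum>y\<in>B. \<Sum>w\<in>nbrs E y. (f y)\<^sup>2 / 2 + (f w)\<^sup>2 / 2 - (f y - f w)\<^sup>2 / 4)"
    by (intro sum.cong refl) (simp add: power2_eq_square field_simps)
  also have "\<dots> = (\<Sum>y\<in>B. deg y * (f y)\<^sup>2) / 2 + (\<Sum>y\<in>B. \<Sum>w\<in>nbrs E y. (f w)\<^sup>2) / 2
      - (\<Sum>y\<in>B. \<Sum>w\<in>nbrs E y. (f y - f w)\<^sup>2) / 4"
    by (simp add: sum.distrib sum_subtractf card_nbrs flip: sum_divide_distrib)
  also have "(\<Sum>y\<in>B. deg y * (f y)\<^sup>2) = ?N"
    by (rule sum.mono_neutral_right) (use B AB f in auto)
  also have "(\<Sum>y\<in>B. \<Sum>w\<in>nbrs E y. (f w)\<^sup>2) = ?N"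
    by (rule sum_nbrs_swap[OF B AB]) (use f in auto)
  finally have 1: "(\<Sum>y\<in>B. deg y * (f y / 2 + (\<Sum>w\<in>nbrs E y. f w) / (2 * deg y))\<^sup>2) \<le>
      ?N - (\<Sum>y\<in>B. \<Sum>w\<in>nbrs E y. (f y - f w)\<^sup>2) / 4" by simp
  have "\<kappa>\<^sup>2 / 4 * ?N \<le> (\<Sum>x\<in>A. \<Sum>y\<in>nbrs E x. (max 0 (f x - f y))\<^sup>2)"
    by (rule cheeger[OF finA _ f \<kappa> iso]) (use AB B in auto)
  also have "\<dots> \<le> (\<Sum>x\<in>A. \<Sum>y\<in>nbrs E x. (f x - f y)\<^sup>2)"
    by (intro sum_mono) (auto simp: max_def)
  also have "\<dots> \<le> (\<Sum>x\<in>B. \<Sum>y\<in>nbrs E x. (f x - f y)\<^sup>2)"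
    by (rule sum_mono2) (use AB B in \<open>auto intro: sum_nonneg\<close>)
  finally show ?thesis using 1 by (simp add: left_diff_distrib)
qed

text \<open>By the first-step formula the column \<open>y \<mapsto> P n y x\<close> evolves under
  the lazy Markov operator, so each step contracts its energy by
  \<open>1 - \<kappa>\<^sup>2 / 16\<close>, which is at most
  \<open>exp (- (\<kappa>\<^sup>2 / 16))\<close>.\<close>

lemma energy_decay:
  fixes \<kappa> :: real
  assumes x: "x \<in> V" and \<kappa>: "\<kappa> > 0"
    and iso: "\<And>U. finite U \<Longrightarrow> U \<subseteq> V \<Longrightarrow> \<kappa> * vol U \<le> bd U"
  shows "(\<Sum>y\<in>support n x. deg y * (P n y x)\<^sup>2) \<le> exp (- (\<kappa>\<^sup>2 / 16 * n)) * deg x"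
proof (induction n)
  case 0
  then show ?case by (simp add: transition_def)
next
  case (Suc n)
  let ?A = "support n x" and ?B = "support (Suc n) x"
  have AV: "?A \<subseteq> V" and BV: "?B \<subseteq> V" by (rule support_subset[OF x])+
  \<comment> \<open>By reversibility this cutoff changes nothing on \<open>V\<close>; it makes
    \<open>f\<close> vanish outside \<open>V\<close> as well, where the walk carries no
    meaning.\<close>
  define f where "f y = (if y \<in> ?A then P n y x else 0)" for y
  have f: "f y = P n y x" if "y \<in> V" for y
  proof (cases "y \<in> ?A")
    case False
    then have "deg y * P n y x = 0" using reversible[OF x that, of n] by (simp add: P_eq_0)
    then show ?thesis using False deg_pos[OF that] by (simp add: f_def)
  qed (simp add: f_def)
  have "(\<Sum>y\<in>?B. deg y * (P (Suc n) y x)\<^sup>2) =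
      (\<Sum>y\<in>?B. deg y * (f y / 2 + (\<Sum>w\<in>nbrs E y. f w) / (2 * deg y))\<^sup>2)"
  proof (rule sum.cong[OF refl])
    fix y assume "y \<in> ?B"
    then have y: "y \<in> V" using BV by auto
    have "(\<Sum>w\<in>nbrs E y. f w) = (\<Sum>w\<in>nbrs E y. P n w x)"
      by (rule sum.cong[OF refl], rule f, erule nbrsD(2))
    then show "deg y * (P (Suc n) y x)\<^sup>2 = deg y * (f y / 2 + (\<Sum>w\<in>nbrs E y. f w) / (2 * deg y))\<^sup>2"
      by (simp only: P_Suc_left[OF y] f[OF y])
  qed
  also have "\<dots> \<le> (1 - \<kappa>\<^sup>2 / 16) * (\<Sum>y\<in>?A. deg y * (f y)\<^sup>2)"
  proof (rule lazy_step_contraction[OF _ BV _ _ _ _ \<kappa> iso])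
    show "finite ?B" by (rule finite_support[OF x])
    show "?A \<subseteq> ?B" unfolding support_Suc_right[OF AV] by auto
    show "nbrs E y \<subseteq> ?B" if "y \<in> ?A" for y using that unfolding support_Suc_right[OF AV] by auto
  qed (auto simp: f_def P_nonneg)
  also have "(\<Sum>y\<in>?A. deg y * (f y)\<^sup>2) = (\<Sum>y\<in>?A. deg y * (P n y x)\<^sup>2)"
    by (simp add: f_def)
  also have "(1 - \<kappa>\<^sup>2 / 16) * \<dots> \<le> exp (- (\<kappa>\<^sup>2 / 16)) * \<dots>"
    by (rule mult_right_mono) (use exp_ge_add_one_self[of "- (\<kappa>\<^sup>2 / 16)"] in \<open>auto intro: sum_nonneg\<close>)
  also have "\<dots> \<le> exp (- (\<kappa>\<^sup>2 / 16)) * (exp (- (\<kappa>\<^sup>2 / 16 * n)) * deg x)"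
    by (rule mult_left_mono[OF Suc]) simp
  also have "\<dots> = exp (- (\<kappa>\<^sup>2 / 16 * Suc n)) * deg x"
    by (simp add: algebra_simps flip: exp_add)
  finally show ?case .
qed

section \<open>Entropy: linear growth under nonamenability, and growth bounded by total
  variation\<close>

definition entropy :: "nat \<Rightarrow> 'a \<Rightarrow> real" where
  "entropy n x = (\<Sum>z\<in>support n x. P n x z * (- ln (P n x z)))"

lemma entropy_superset:
  assumes "finite F" "support n x \<subseteq> F"
  shows "entropy n x = (\<Sum>z\<in>F. P n x z * (- ln (P n x z)))"
  unfolding entropy_def by (rule sum.mono_neutral_left) (use assms P_eq_0 in auto)

text \<open>Entropy is at least minus the logarithm of the collision probability, the sum of
  \<open>(P n x y)\<^sup>2\<close>. Reversibility bounds the latter by the energy of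
  \<open>energy_decay\<close>.\<close>

lemma entropy_lower_bound:
  fixes \<kappa> :: real
  assumes x: "x \<in> V" and \<kappa>: "\<kappa> > 0"
    and iso: "\<And>U. finite U \<Longrightarrow> U \<subseteq> V \<Longrightarrow> \<kappa> * vol U \<le> bd U"
  shows "entropy n x \<ge> \<kappa>\<^sup>2 / 16 * n - ln D"
proof -
  let ?S = "support n x"
  have dx: "deg x > 0" by (rule deg_pos[OF x])
  \<comment> \<open>\<open>s\<close> will bound the collision probability: one factor
    \<open>deg y\<close> is estimated by \<open>D\<close>, and a remaining factor
    \<open>1 / deg x\<close> by 1.\<close>
  define s where "s = D * exp (- (\<kappa>\<^sup>2 / 16 * n))"
  have s_pos: "s > 0" using D_pos by (simp add: s_def)
  have "(\<Sum>y\<in>?S. (P n x y)\<^sup>2) \<le> (\<Sum>y\<in>?S. D * (deg y * (P n y x)\<^sup>2) / (deg x)\<^sup>2)"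
  proof (rule sum_mono)
    fix y assume "y \<in> ?S"
    then have y: "y \<in> V" using support_subset[OF x] by auto
    have "(P n x y)\<^sup>2 = (deg x * P n x y)\<^sup>2 / (deg x)\<^sup>2" using dx by (simp add: power_mult_distrib)
    also have "\<dots> = deg y * (deg y * (P n y x)\<^sup>2) / (deg x)\<^sup>2"
      by (simp only: reversible[OF x y]) (simp add: power2_eq_square)
    also have "\<dots> \<le> D * (deg y * (P n y x)\<^sup>2) / (deg x)\<^sup>2"
      by (intro divide_right_mono mult_right_mono) (use degree_le[OF y] in auto)
    finally show "(P n x y)\<^sup>2 \<le> D * (deg y * (P n y x)\<^sup>2) / (deg x)\<^sup>2" .
  qed
  also have "\<dots> = D * (\<Sum>y\<in>?S. deg y * (P n y x)\<^sup>2) / (deg x)\<^sup>2"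
    by (simp add: sum_distrib_left flip: sum_divide_distrib)
  also have "\<dots> \<le> D * (exp (- (\<kappa>\<^sup>2 / 16 * n)) * deg x) / (deg x)\<^sup>2"
    by (intro divide_right_mono mult_left_mono energy_decay[OF x \<kappa> iso]) auto
  also have "\<dots> = s / deg x" using dx by (simp add: s_def power2_eq_square)
  also have "\<dots> \<le> s" using dx s_pos by (simp add: field_simps)
  finally have sq: "(\<Sum>y\<in>?S. (P n x y)\<^sup>2) \<le> s" .
  have "(\<Sum>y\<in>?S. P n x y * (1 - ln s) - (P n x y)\<^sup>2 / s) \<le> entropy n x"
    unfolding entropy_def
  proof (rule sum_mono)
    fix y assume "y \<in> ?S"
    then have pos: "P n x y > 0" by (rule P_pos)
    \<comment> \<open>Tangent of \<open>ln\<close> at \<open>s\<close>. After weighting and summing,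
      its linear term costs at most 1, because the collision probability is at most
      \<open>s\<close>, and this cancels the constant 1.\<close>
    have "ln (P n x y / s) \<le> P n x y / s - 1" by (rule ln_le_minus_one) (use pos s_pos in simp)
    then have "1 - ln s - P n x y / s \<le> - ln (P n x y)" using pos s_pos by (simp add: ln_div)
    then have "P n x y * (1 - ln s - P n x y / s) \<le> P n x y * (- ln (P n x y))"
      using pos by (intro mult_left_mono) auto
    then show "P n x y * (1 - ln s) - (P n x y)\<^sup>2 / s \<le> P n x y * (- ln (P n x y))"
      by (simp add: right_diff_distrib power2_eq_square)
  qed
  moreover have "(\<Sum>y\<in>?S. P n x y * (1 - ln s) - (P n x y)\<^sup>2 / s) =
      (1 - ln s) - (\<Sum>y\<in>?S. (P n x y)\<^sup>2) / s"
    using sum_P[of ?S n x] finite_support[OF x]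
    by (simp add: sum_subtractf flip: sum_divide_distrib sum_distrib_right)
  moreover have "(\<Sum>y\<in>?S. (P n x y)\<^sup>2) / s \<le> 1" using sq s_pos by simp
  ultimately have "entropy n x \<ge> - ln s" by linarith
  then show ?thesis using D_pos by (simp add: s_def ln_mult)
qed

text \<open>The difference of the two entropy sums is the relative entropy of \<open>p\<close> with
  respect to \<open>q\<close>. By \<open>ln u \<le> u - 1\<close> it is at most the sum of
  \<open>(p / q) * (p - q)\<close>, and the density bound \<open>c\<close> makes this linear in the
  l^1 distance.\<close>

lemma relative_entropy_le:
  fixes p q :: "'a \<Rightarrow> real"
  assumes "\<And>z. z \<in> F \<Longrightarrow> p z \<ge> 0" "\<And>z. z \<in> F \<Longrightarrow> q z > 0" "\<And>z. z \<in> F \<Longrightarrow> p z \<le> c * q z"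
    and "c \<ge> 0"
  shows "(\<Sum>z\<in>F. p z * (- ln (q z))) \<le> (\<Sum>z\<in>F. p z * (- ln (p z))) + c * (\<Sum>z\<in>F. \<bar>p z - q z\<bar>)"
proof -
  have "p z * (- ln (q z)) \<le> p z * (- ln (p z)) + c * \<bar>p z - q z\<bar>" if z: "z \<in> F" for z
  proof (cases "p z = 0")
    case False
    then have p: "p z > 0" and q: "q z > 0" using assms(1,2)[OF z] by auto
    have "ln (p z / q z) \<le> p z / q z - 1" by (rule ln_le_minus_one) (use p q in simp)
    then have "ln (p z) - ln (q z) \<le> (p z - q z) / q z" using p q by (simp add: ln_div diff_divide_distrib)
    then have "p z * (ln (p z) - ln (q z)) \<le> p z * ((p z - q z) / q z)"
      using p by (intro mult_left_mono) auto
    also have "\<dots> = (p z / q z) * (p z - q z)" by simp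
    also have "\<dots> \<le> (p z / q z) * \<bar>p z - q z\<bar>"
      by (rule mult_left_mono) (use p q in auto)
    also have "\<dots> \<le> c * \<bar>p z - q z\<bar>"
      by (rule mult_right_mono) (use assms(3)[OF z] q in \<open>auto simp: field_simps\<close>)
    finally show ?thesis by (simp add: right_diff_distrib)
  qed (use assms(4) in auto)
  then have "(\<Sum>z\<in>F. p z * (- ln (q z))) \<le> (\<Sum>z\<in>F. p z * (- ln (p z)) + c * \<bar>p z - q z\<bar>)"
    by (rule sum_mono)
  then show ?thesis by (simp only: sum.distrib sum_distrib_left)
qed

text \<open>The law \<open>q\<close> at time \<open>Suc n\<close> is a mixture, and its entropy is
  the same mixture of the cross entropies of the components against \<open>q\<close>. Each cross
  entropy exceeds the entropy of its component by a relative entropy, at most \<open>2 * D\<close>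
  (density) times \<open>3 * \<tau>\<close> (l^1 distance).\<close>

lemma entropy_Suc_le:
  fixes \<tau> :: real
  assumes x: "x \<in> V"
    and lip: "\<And>y F. y \<in> nbrs E x \<Longrightarrow> finite F \<Longrightarrow> (\<Sum>z\<in>F. \<bar>P n x z - P n y z\<bar>) \<le> 2 * \<tau>"
  shows "entropy (Suc n) x \<le>
    entropy n x / 2 + (\<Sum>y\<in>nbrs E x. entropy n y) / (2 * deg x) + 6 * D * \<tau>"
proof -
  let ?F = "support (Suc n) x" and ?q = "P (Suc n) x"
  have dx: "deg x > 0" by (rule deg_pos[OF x])
  have finN: "finite (nbrs E x)" by (rule finite_nbrs[OF x])
  have finF: "finite ?F" by (rule finite_support[OF x])
  have sub: "support n y \<subseteq> ?F" if "y \<in> insert x (nbrs E x)" for y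
    using that unfolding support_Suc[OF x] by auto
  have \<tau>: "\<tau> \<ge> 0"
    using nbrs_nonempty[OF x] lip[of _ "{}"] by fastforce
  have q: "?q z = P n x z / 2 + (\<Sum>y\<in>nbrs E x. P n y z) / (2 * deg x)" for z
    by (rule P_Suc_left[OF x])
  \<comment> \<open>The difference of \<open>P n x\<close> and \<open>?q\<close> is half the average
    of its differences with the \<open>P n y\<close>, so it costs \<open>\<tau>\<close> instead of
    \<open>2 * \<tau>\<close>.\<close>
  have xq: "(\<Sum>z\<in>?F. \<bar>P n x z - ?q z\<bar>) \<le> \<tau>"
  proof -
    have "\<bar>P n x z - ?q z\<bar> \<le> (\<Sum>y\<in>nbrs E x. \<bar>P n x z - P n y z\<bar>) / (2 * deg x)" for z
    proof -
      have "P n x z - ?q z = (\<Sum>y\<in>nbrs E x. P n x z - P n y z) / (2 * deg x)"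
        using dx by (simp add: q sum_subtractf card_nbrs diff_divide_distrib)
      then show ?thesis by (simp add: abs_divide divide_right_mono sum_abs)
    qed
    then have "(\<Sum>z\<in>?F. \<bar>P n x z - ?q z\<bar>) \<le>
        (\<Sum>z\<in>?F. (\<Sum>y\<in>nbrs E x. \<bar>P n x z - P n y z\<bar>) / (2 * deg x))"
      by (intro sum_mono)
    also have "\<dots> = (\<Sum>y\<in>nbrs E x. \<Sum>z\<in>?F. \<bar>P n x z - P n y z\<bar>) / (2 * deg x)"
      by (simp add: sum.swap[of _ "nbrs E x"] flip: sum_divide_distrib)
    also have "\<dots> \<le> (\<Sum>y\<in>nbrs E x. 2 * \<tau>) / (2 * deg x)"
      by (intro divide_right_mono sum_mono lip finF) auto
    also have "\<dots> = \<tau>" using dx by (simp add: card_nbrs)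
    finally show ?thesis .
  qed
  have cross: "(\<Sum>z\<in>?F. P n y z * (- ln (?q z))) \<le> entropy n y + 6 * D * \<tau>"
    if y: "y \<in> insert x (nbrs E x)" for y
  proof -
    have xy: "(\<Sum>z\<in>?F. \<bar>P n x z - P n y z\<bar>) \<le> 2 * \<tau>"
      using y lip[OF _ finF, of y] \<tau> by (cases "y = x") auto
    have "(\<Sum>z\<in>?F. \<bar>P n y z - ?q z\<bar>) \<le> (\<Sum>z\<in>?F. \<bar>P n x z - P n y z\<bar> + \<bar>P n x z - ?q z\<bar>)"
      by (rule sum_mono) linarith
    then have yq: "(\<Sum>z\<in>?F. \<bar>P n y z - ?q z\<bar>) \<le> 3 * \<tau>" using xy xq by (simp add: sum.distrib)
    \<comment> \<open>Every component has weight at least \<open>1 / (2 * deg x)\<close> in the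
      mixture \<open>?q\<close>.\<close>
    have dom: "P n y z \<le> 2 * D * ?q z" for z
    proof -
      have S: "0 \<le> (\<Sum>y\<in>nbrs E x. P n y z)" by (intro sum_nonneg P_nonneg)
      have S': "P n y z \<le> deg x * P n x z + (\<Sum>y\<in>nbrs E x. P n y z)"
      proof (cases "y = x")
        case True
        have "1 * P n x z \<le> deg x * P n x z" by (rule mult_right_mono) (use dx P_nonneg in auto)
        then show ?thesis using True S by simp
      next
        case False
        then have "P n y z \<le> (\<Sum>y\<in>nbrs E x. P n y z)"
          using y finN by (intro member_le_sum) (auto simp: P_nonneg)
        then show ?thesis using P_nonneg[of n x z] by (smt (verit) mult_nonneg_nonneg of_nat_0_le_iff)
      qed
      also have "\<dots> = 2 * deg x * ?q z" using dx by (simp add: q field_simps)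
      also have "\<dots> \<le> 2 * D * ?q z"
        by (intro mult_right_mono P_nonneg) (use degree_le[OF x] in auto)
      finally show ?thesis .
    qed
    have "(\<Sum>z\<in>?F. P n y z * (- ln (?q z))) \<le>
        (\<Sum>z\<in>?F. P n y z * (- ln (P n y z))) + (2 * D) * (\<Sum>z\<in>?F. \<bar>P n y z - ?q z\<bar>)"
      by (rule relative_entropy_le) (use P_nonneg P_pos dom in auto)
    also have "(\<Sum>z\<in>?F. P n y z * (- ln (P n y z))) = entropy n y"
      by (rule entropy_superset[symmetric, OF finF sub[OF y]])
    also have "(2 * D) * (\<Sum>z\<in>?F. \<bar>P n y z - ?q z\<bar>) \<le> (2 * D) * (3 * \<tau>)"
      by (rule mult_left_mono[OF yq]) simp
    finally show ?thesis by simp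
  qed
  have "entropy (Suc n) x = (\<Sum>z\<in>?F. ?q z * (- ln (?q z)))"
    by (simp add: entropy_def)
  also have "\<dots> = (\<Sum>z\<in>?F. P n x z * (- ln (?q z)) / 2 +
      (\<Sum>y\<in>nbrs E x. P n y z * (- ln (?q z))) / (2 * deg x))"
  proof (rule sum.cong[OF refl])
    fix z
    have "r = a / 2 + s / d \<Longrightarrow> r * l = a * l / 2 + (s * l) / d" for r a s d l :: real
      by (simp add: distrib_right)
    from this[OF q] show "?q z * (- ln (?q z)) = P n x z * (- ln (?q z)) / 2 +
      (\<Sum>y\<in>nbrs E x. P n y z * (- ln (?q z))) / (2 * deg x)"
      unfolding sum_distrib_right .
  qed
  also have "\<dots> = (\<Sum>z\<in>?F. P n x z * (- ln (?q z))) / 2 +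
      (\<Sum>y\<in>nbrs E x. \<Sum>z\<in>?F. P n y z * (- ln (?q z))) / (2 * deg x)"
    unfolding sum.distrib sum_divide_distrib[symmetric] sum.swap[of _ "nbrs E x"] ..
  also have "\<dots> \<le> (entropy n x + 6 * D * \<tau>) / 2 +
      (\<Sum>y\<in>nbrs E x. entropy n y + 6 * D * \<tau>) / (2 * deg x)"
    by (intro add_mono divide_right_mono sum_mono cross) auto
  also have "\<dots> = entropy n x / 2 + (\<Sum>y\<in>nbrs E x. entropy n y) / (2 * deg x) + 6 * D * \<tau>"
    using dx by (simp add: sum.distrib card_nbrs add_divide_distrib)
  finally show ?thesis .
qed

text \<open>The one-step bound averages over neighbours, so the induction carries a bound uniform in
  the starting vertex.\<close>

lemma entropy_le_sum:
  fixes \<tau> :: "nat \<Rightarrow> real"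
  assumes lip: "\<And>n x y F. x \<in> V \<Longrightarrow> y \<in> nbrs E x \<Longrightarrow> finite F \<Longrightarrow>
      (\<Sum>z\<in>F. \<bar>P n x z - P n y z\<bar>) \<le> 2 * \<tau> n"
    and "x \<in> V"
  shows "entropy n x \<le> 6 * D * (\<Sum>j<n. \<tau> j)"
  using \<open>x \<in> V\<close>
proof (induction n arbitrary: x)
  case 0
  then show ?case by (simp add: entropy_def transition_def)
next
  case (Suc n)
  let ?b = "6 * D * (\<Sum>j<n. \<tau> j)"
  have dx: "deg x > 0" by (rule deg_pos[OF Suc.prems])
  have "entropy (Suc n) x \<le>
      entropy n x / 2 + (\<Sum>y\<in>nbrs E x. entropy n y) / (2 * deg x) + 6 * D * \<tau> n"
    by (rule entropy_Suc_le[OF Suc.prems lip[OF Suc.prems]])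
  also have "\<dots> \<le> ?b / 2 + (\<Sum>y\<in>nbrs E x. ?b) / (2 * deg x) + 6 * D * \<tau> n"
    by (intro add_mono divide_right_mono sum_mono Suc.IH Suc.prems) (auto dest: nbrsD(2))
  also have "\<dots> = 6 * D * (\<Sum>j<Suc n. \<tau> j)"
    using dx by (simp add: card_nbrs distrib_left)
  finally show ?case .
qed

text \<open>A uniform constant \<open>\<kappa>\<close> would force entropy to grow with slope
  \<open>\<kappa>\<^sup>2 / 16\<close>, whereas \<open>\<tau>\<close> tending to 0 makes the
  increments in \<open>entropy_le_sum\<close> eventually smaller than that.\<close>

lemma not_nonamenable:
  fixes \<tau> :: "nat \<Rightarrow> real" and \<kappa> :: real
  assumes lip: "\<And>n x y F. x \<in> V \<Longrightarrow> y \<in> nbrs E x \<Longrightarrow> finite F \<Longrightarrow>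
      (\<Sum>z\<in>F. \<bar>P n x z - P n y z\<bar>) \<le> 2 * \<tau> n"
    and \<tau>: "\<tau> \<longlonglongrightarrow> 0" and \<kappa>: "\<kappa> > 0"
  shows "\<exists>U. finite U \<and> U \<subseteq> V \<and> bd U < \<kappa> * vol U"
proof (rule ccontr)
  assume "\<not> ?thesis"
  then have iso: "\<kappa> * vol U \<le> bd U" if "finite U" "U \<subseteq> V" for U
    using that by (meson not_le)
  obtain x where x: "x \<in> V" using V_nonempty by auto
  define \<eta> where "\<eta> = \<kappa>\<^sup>2 / 16"
  have \<eta>: "\<eta> > 0" using \<kappa> by (simp add: \<eta>_def)
  \<comment> \<open>Past \<open>j0\<close> each step adds at most
    \<open>6 * D * (\<eta> / (12 * D)) = \<eta> / 2\<close> to the upper bound, half of the slope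
    forced from below.\<close>
  have "\<eta> / (12 * D) > 0" using \<eta> D_pos by simp
  then have "eventually (\<lambda>n. \<tau> n < \<eta> / (12 * D)) sequentially"
    using order_tendstoD(2)[OF \<tau>] by blast
  then obtain j0 where j0: "\<And>j. j \<ge> j0 \<Longrightarrow> \<tau> j < \<eta> / (12 * D)"
    unfolding eventually_sequentially by blast
  define C where "C = 6 * D * (\<Sum>j<j0. \<tau> j)"
  have "\<eta> * (j0 + k) - ln D \<le> C + k * (\<eta> / 2)" for k
  proof -
    have "\<eta> * (j0 + k) - ln D \<le> entropy (j0 + k) x"
      using entropy_lower_bound[OF x \<kappa> iso, of "j0 + k"] by (simp add: \<eta>_def)
    also have "\<dots> \<le> 6 * D * (\<Sum>j<j0 + k. \<tau> j)" by (rule entropy_le_sum[OF lip x])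
    also have "(\<Sum>j<j0 + k. \<tau> j) = (\<Sum>j<j0. \<tau> j) + (\<Sum>j<k. \<tau> (j0 + j))"
      by (induction k) auto
    also have "6 * D * \<dots> = C + 6 * D * (\<Sum>j<k. \<tau> (j0 + j))"
      by (simp add: C_def distrib_left)
    also have "6 * D * (\<Sum>j<k. \<tau> (j0 + j)) \<le> 6 * D * (\<Sum>j<k. \<eta> / (12 * D))"
      by (intro mult_left_mono sum_mono less_imp_le[OF j0] le_add1) simp
    also have "6 * D * (\<Sum>j<k. \<eta> / (12 * D)) = k * (\<eta> / 2)"
      using D_pos by simp
    finally show ?thesis by simp
  qed
  then have bound: "k * (\<eta> / 2) \<le> C + ln D" for k :: nat
  proof -
    have "0 \<le> \<eta> * j0" using \<eta> by simp
    then show ?thesis using \<open>\<And>k. \<eta> * (j0 + k) - ln D \<le> C + k * (\<eta> / 2)\<close>[of k]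
      by (simp add: distrib_left algebra_simps)
  qed
  obtain k :: nat where "C + ln D < k * (\<eta> / 2)"
    using ex_less_of_nat_mult[of "\<eta> / 2" "C + ln D"] \<eta> by auto
  then show False using bound[of k] by simp
qed

section \<open>Linking \<open>TV\<close>, \<open>max_entropy\<close> and the profile to finite
  sums\<close>

lemma sum_abs_diff_eq_infsum:
  assumes "x \<in> V" "y \<in> V"
  shows "(\<Sum>\<^sub>\<infinity>z\<in>V. \<bar>P n x z - P n y z\<bar>) = (\<Sum>z\<in>support n x \<union> support n y. \<bar>P n x z - P n y z\<bar>)"
proof -
  have "(\<Sum>\<^sub>\<infinity>z\<in>V. \<bar>P n x z - P n y z\<bar>) = (\<Sum>\<^sub>\<infinity>z\<in>support n x \<union> support n y. \<bar>P n x z - P n y z\<bar>)"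
    by (rule infsum_cong_neutral) (use support_subset assms P_eq_0 in auto)
  then show ?thesis using finite_support assms by simp
qed

lemma sum_abs_diff_le_2:
  assumes "x \<in> V" "y \<in> V"
  shows "(\<Sum>z\<in>support n x \<union> support n y. \<bar>P n x z - P n y z\<bar>) \<le> 2"
proof -
  let ?G = "support n x \<union> support n y"
  have fin: "finite ?G" using finite_support assms by auto
  have "\<bar>P n x z - P n y z\<bar> \<le> P n x z + P n y z" for z
    using P_nonneg[of n x z] P_nonneg[of n y z] by linarith
  then have "(\<Sum>z\<in>?G. \<bar>P n x z - P n y z\<bar>) \<le> (\<Sum>z\<in>?G. P n x z + P n y z)"
    by (rule sum_mono)
  also have "\<dots> = 2" using sum_P[OF fin, of n x] sum_P[OF fin, of n y] by (simp add: sum.distrib)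
  finally show ?thesis .
qed

lemma sum_abs_diff_le_support:
  assumes "x \<in> V" "y \<in> V" "finite F"
  shows "(\<Sum>z\<in>F. \<bar>P n x z - P n y z\<bar>) \<le> (\<Sum>z\<in>support n x \<union> support n y. \<bar>P n x z - P n y z\<bar>)"
proof -
  let ?G = "support n x \<union> support n y"
  have fin: "finite ?G" using finite_support assms by auto
  have "(\<Sum>z\<in>F. \<bar>P n x z - P n y z\<bar>) \<le> (\<Sum>z\<in>F \<union> ?G. \<bar>P n x z - P n y z\<bar>)"
    by (rule sum_mono2) (use assms(3) fin in auto)
  also have "\<dots> = (\<Sum>z\<in>?G. \<bar>P n x z - P n y z\<bar>)"
    by (rule sum.mono_neutral_right) (use assms(3) fin P_eq_0 in auto)
  finally show ?thesis .
qed

lemma sum_abs_diff_le_TV: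
  assumes x: "x \<in> V" and y: "y \<in> nbrs E x" and F: "finite F"
  shows "(\<Sum>z\<in>F. \<bar>P n x z - P n y z\<bar>) \<le> 2 * TV V E n"
proof -
  have yV: "y \<in> V" by (rule nbrsD(2)[OF y])
  let ?I = "{(x, y). x \<in> V \<and> y \<in> V \<and> adjacent E x y}"
  let ?f = "\<lambda>(x, y). 1/2 * (\<Sum>\<^sub>\<infinity>z\<in>V. \<bar>P n x z - P n y z\<bar>)"
  \<comment> \<open>A real supremum is known to be an upper bound only for a set bounded above; the
    trivial l^1 bound 2 supplies this.\<close>
  have "bdd_above (?f ` ?I)"
  proof (rule bdd_aboveI2)
    fix p assume "p \<in> ?I"
    then show "?f p \<le> 1"
      using sum_abs_diff_eq_infsum sum_abs_diff_le_2 by (cases p) auto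
  qed
  then have "?f (x, y) \<le> TV V E n"
    unfolding TV_def by (rule cSUP_upper[rotated]) (use x yV y in \<open>simp add: nbrs_def\<close>)
  then show ?thesis
    using sum_abs_diff_le_support[OF x yV F, of n] sum_abs_diff_eq_infsum[OF x yV, of n] by simp
qed

lemma entropy_le_max_entropy:
  assumes x: "x \<in> V" and "m \<le> n"
  shows "entropy m x \<le> max_entropy V E n"
proof -
  have eq: "(\<Sum>\<^sub>\<infinity>z\<in>V. P k y z * (- ln (P k y z))) = entropy k y" if "y \<in> V" for k y
  proof -
    have "(\<Sum>\<^sub>\<infinity>z\<in>V. P k y z * (- ln (P k y z))) = (\<Sum>\<^sub>\<infinity>z\<in>support k y. P k y z * (- ln (P k y z)))"
      by (rule infsum_cong_neutral) (use support_subset that P_eq_0 in auto)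
    then show ?thesis using finite_support[OF that] by (simp add: entropy_def)
  qed
  \<comment> \<open>Boundedness for the supremum over \<open>V\<close>, from
    \<open>entropy_le_sum\<close> with the trivial choice \<open>\<tau> = 1\<close>.\<close>
  have bound: "entropy k y \<le> 6 * D * n" if "y \<in> V" "k \<le> n" for k y
  proof -
    have "entropy k y \<le> 6 * D * (\<Sum>j<k. 1 :: real)"
    proof (rule entropy_le_sum[OF _ that(1)])
      fix j u w and F :: "'a set" assume "u \<in> V" "w \<in> nbrs E u" "finite F"
      then show "(\<Sum>z\<in>F. \<bar>P j u z - P j w z\<bar>) \<le> 2 * 1"
        using sum_abs_diff_le_support[of u w F j] sum_abs_diff_le_2[of u w j] nbrsD(2)[of w u] by simp
    qed
    also have "\<dots> \<le> 6 * D * n" using that(2) by (simp add: mult_left_mono)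
    finally show ?thesis .
  qed
  let ?g = "\<lambda>y. MAX k\<in>{0..n}. \<Sum>\<^sub>\<infinity>z\<in>V. P k y z * (- ln (P k y z))"
  have g: "?g y = (MAX k\<in>{0..n}. entropy k y)" if "y \<in> V" for y
    by (simp only: eq[OF that])
  have "entropy m x \<le> ?g x"
    unfolding g[OF x] using assms(2) by (intro Max_ge) auto
  also have "?g x \<le> max_entropy V E n"
    unfolding max_entropy_def
  proof (rule cSUP_upper[OF x], rule bdd_aboveI2)
    fix y assume y: "y \<in> V"
    show "?g y \<le> 6 * D * n"
      unfolding g[OF y] by (intro Max.boundedI) (use bound[OF y] in auto)
  qed
  finally show ?thesis .
qed

lemma isoperimetric_profile_le:
  assumes W: "finite W" "W \<subseteq> V" "W \<noteq> {}" "vol W \<le> n"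
  shows "isoperimetric_profile V E n * vol W \<le> bd W"
proof -
  have "isoperimetric_profile V E n \<le> real (card (edge_boundary E W)) / real (\<Sum>w\<in>W. deg w)"
    unfolding isoperimetric_profile_def
    by (rule cInf_lower) (use W in \<open>auto simp: vol_def intro!: bdd_belowI[of _ 0] divide_nonneg_nonneg sum_nonneg\<close>)
  also have "\<dots> = bd W / vol W"
    by (simp add: card_edge_boundary[OF W(1,2)] vol_def)
  finally show ?thesis using vol_pos[OF W(1-3)] by (simp add: field_simps)
qed

text \<open>\<open>D \<le> n\<close> makes every singleton in \<open>V\<close> admissible, so the
  infimum is not the arbitrary value at the empty set.\<close>

lemma isoperimetric_profile_nonneg:
  assumes "D \<le> n"
  shows "isoperimetric_profile V E n \<ge> 0"
proof -
  obtain x where "x \<in> V" using V_nonempty by auto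
  then have x: "{x} \<subseteq> V" "(\<Sum>w\<in>{x}. deg w) \<le> n" using degree_le[of x] assms by auto
  show ?thesis
    unfolding isoperimetric_profile_def by (rule cInf_greatest) (use x in blast, auto intro!: divide_nonneg_nonneg sum_nonneg)
qed

text \<open>Otherwise \<open>localization\<close> would make
  \<open>\<phi> / 4 - 2 * TV V E m\<close> a positive isoperimetric constant for all finite sets,
  against \<open>not_nonamenable\<close>; the factor 8 is what makes it positive.\<close>

lemma isoperimetric_profile_le_TV:
  assumes TV: "TV V E \<longlonglongrightarrow> 0"
    and h: "max_entropy V E m \<le> h" "h > 0" and n: "2 * D * exp (2 * h) \<le> n"
  shows "isoperimetric_profile V E n \<le> 8 * TV V E m"
proof (rule ccontr)
  assume neg: "\<not> ?thesis"
  define \<phi> where "\<phi> = isoperimetric_profile V E n"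
  define t where "t = exp (- (2 * h)) / 2"
  have TV_nonneg: "TV V E m \<ge> 0"
  proof -
    obtain x y where "x \<in> V" "y \<in> nbrs E x" using V_nonempty nbrs_nonempty by blast
    from sum_abs_diff_le_TV[OF this, of "{}"] show ?thesis by simp
  qed
  have gt: "\<phi> > 8 * TV V E m" using neg by (simp add: \<phi>_def)
  have "(\<phi> / 4 - 2 * TV V E m) * vol W \<le> bd W" if W: "finite W" "W \<subseteq> V" for W
  proof (rule localization[OF W _ sum_abs_diff_le_TV])
    show "\<phi> \<ge> 0" using gt TV_nonneg by simp
    show "t > 0" by (simp add: t_def)
    show "1/4 \<le> (\<Sum>z\<in>support m x. max 0 (P m x z - t))" if x: "x \<in> V" for x
      unfolding t_def
    proof (rule quarter_le_sum_truncated[OF P_nonneg P_le_1 _ _ h(2)])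
      show "(\<Sum>z\<in>support m x. P m x z) = 1" by (rule sum_P[OF finite_support[OF x]]) simp
      show "(\<Sum>z\<in>support m x. P m x z * (- ln (P m x z))) \<le> h"
        using entropy_le_max_entropy[OF x order_refl, of m] h(1) unfolding entropy_def by linarith
    qed
    fix U assume U: "finite U" "U \<subseteq> V" "U \<noteq> {}" "t * vol U \<le> D"
    \<comment> \<open>The volume threshold \<open>D / t\<close> equals
      \<open>2 * D * exp (2 * h)\<close>, which is at most \<open>n\<close>, so the profile at
      \<open>n\<close> controls \<open>U\<close>.\<close>
    have "real (vol U) = t * vol U * (2 * exp (2 * h))"
      by (simp add: t_def exp_minus)
    also have "\<dots> \<le> D * (2 * exp (2 * h))" by (rule mult_right_mono[OF U(4)]) simp
    also have "\<dots> \<le> n" using n by simp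
    finally show "\<phi> * vol U \<le> bd U"
      unfolding \<phi>_def by (intro isoperimetric_profile_le U) simp
  qed
  moreover have "\<exists>U. finite U \<and> U \<subseteq> V \<and> bd U < (\<phi> / 4 - 2 * TV V E m) * vol U"
    by (rule not_nonamenable[OF sum_abs_diff_le_TV TV]) (use gt in auto)
  ultimately show False by force
qed

end

section \<open>Choice of the time and the asymptotic rate\<close>

theorem corollary1p3:
  fixes V :: "'a set" and E :: "'a set set" and \<alpha> \<beta> :: real
  assumes "simple_graph V E"
    and "infinite V"
    and "graph_connected V E"
    and "bounded_degree V E"
    and "\<alpha> \<in> {0<..1}" and "\<beta> \<in> {0<..1}"
    and "(\<lambda>n. max_entropy V E n) \<in> O(\<lambda>n. real n powr \<alpha>)"
    and "(\<lambda>n. TV V E n) \<in> O(\<lambda>n. real n powr (- \<beta>))"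
  shows "(\<lambda>n. isoperimetric_profile V E n)
           \<in> O(\<lambda>n. (ln (ln (real n)) / ln (real n)) powr (\<beta> / \<alpha>))"
proof -
  obtain D where "\<And>x. x \<in> V \<Longrightarrow> finite (incident_edges E x)" "\<And>x. x \<in> V \<Longrightarrow> vertex_degree E x \<le> D"
    using assms(4) unfolding bounded_degree_def by blast
  then interpret bounded_degree_graph V E D
    using assms(1-3) by unfold_locales
  have \<alpha>: "\<alpha> > 0" and \<beta>: "\<beta> > 0" using assms(5,6) by auto
  obtain a where a: "a > 0" and ent: "\<forall>\<^sub>F n in sequentially. norm (max_entropy V E n) \<le> a * norm (real n powr \<alpha>)"
    using landau_o.bigE[OF assms(7)] by blast
  obtain b where b: "b > 0" and tv: "\<forall>\<^sub>F n in sequentially. norm (TV V E n) \<le> b * norm (real n powr (- \<beta>))"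
    using landau_o.bigE[OF assms(8)] by blast
  have "(\<lambda>n. real n powr (- \<beta>)) \<longlonglongrightarrow> 0"
    by (rule tendsto_neg_powr) (use \<beta> in \<open>auto intro: filterlim_real_sequentially\<close>)
  then have TV: "TV V E \<longlonglongrightarrow> 0"
    by (rule Lim_null_comparison[rotated, OF tendsto_mult_right_zero[of _ _ b]]) (use tv in simp)
  obtain N where N: "max_entropy V E m \<le> a * real m powr \<alpha>" "TV V E m \<le> b * real m powr (- \<beta>)"
    if "m \<ge> N" for m
    using eventually_conj[OF ent tv] unfolding eventually_sequentially
    by (metis (mono_tags, lifting) abs_le_D1 abs_of_nonneg powr_ge_zero real_norm_def)
  \<comment> \<open>Chosen so that \<open>a * r n powr \<alpha>\<close> is a quarter of
    \<open>ln n\<close>: for \<open>m \<le> r n\<close> the factor \<open>exp (2 * h)\<close> is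
    then at most the square root of \<open>n\<close>, and the other square root absorbs
    \<open>2 * D\<close>.\<close>
  define r where "r n = (ln (real n) / (4 * a)) powr (1 / \<alpha>)" for n :: nat
  define c where "c = 8 * b * 2 powr \<beta> * (4 * a) powr (\<beta> / \<alpha>)"
  have ln_top: "filterlim (\<lambda>n. ln (real n)) at_top sequentially"
    by (rule filterlim_compose[OF ln_at_top filterlim_real_sequentially])
  \<comment> \<open>The margin \<open>N + 2\<close> ensures that the floor of \<open>r n\<close> is
    at least \<open>N\<close>, positive, and at least \<open>r n / 2\<close>.\<close>
  have "\<forall>\<^sub>F n in sequentially. ln (real n) \<ge> 4 * a * (real N + 2) powr \<alpha>"
    using ln_top by (simp add: filterlim_at_top)
  then have ev_r: "\<forall>\<^sub>F n in sequentially. r n \<ge> real N + 2"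
  proof eventually_elim
    case (elim n)
    then have "(real N + 2) powr \<alpha> \<le> ln (real n) / (4 * a)" using a by (simp add: field_simps)
    then have "((real N + 2) powr \<alpha>) powr (1 / \<alpha>) \<le> r n"
      unfolding r_def using \<alpha> by (intro powr_mono2) auto
    then show ?case using \<alpha> by (simp add: powr_powr)
  qed
  \<comment> \<open>The bound \<open>exp 1\<close> gives \<open>ln (ln n) \<ge> 1\<close>; the bound
    \<open>2 * ln (2 * D)\<close> makes \<open>2 * D\<close> at most the square root of
    \<open>n\<close>.\<close>
  have ev_ln: "\<forall>\<^sub>F n in sequentially. ln (real n) \<ge> max (exp 1) (2 * ln (2 * D))"
    using ln_top unfolding filterlim_at_top by blast
  have "\<forall>\<^sub>F n in sequentially. norm (isoperimetric_profile V E n)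
      \<le> c * norm ((ln (ln (real n)) / ln (real n)) powr (\<beta> / \<alpha>))"
    using ev_r ev_ln eventually_ge_at_top[of "max D 1"]
  proof eventually_elim
    case (elim n)
    define L where "L = ln (real n)"
    define m where "m = nat \<lfloor>r n\<rfloor>"
    have n: "n \<ge> 1" "n \<ge> D" using elim(3) by auto
    have L: "L \<ge> exp 1" "L \<ge> 2 * ln (2 * D)" using elim(2) by (auto simp: L_def)
    have L_pos: "L > 0" using L(1) exp_gt_zero[of "1::real"] by linarith
    have m: "m \<ge> N" "m \<ge> 1" "real m \<le> r n" "real m \<ge> r n / 2"
      using elim(1) unfolding m_def by linarith+
    define h where "h = a * real m powr \<alpha>"
    have h: "h > 0" using a m(2) by (simp add: h_def)
    have "real m powr \<alpha> \<le> r n powr \<alpha>" using m(3) \<alpha> by (intro powr_mono2) auto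
    also have "\<dots> = L / (4 * a)" using a \<alpha> L_pos by (simp add: r_def powr_powr L_def)
    finally have "2 * h \<le> L / 2" using a by (simp add: h_def field_simps)
    then have "ln (2 * D) + 2 * h \<le> L" using L(2) by simp
    then have "exp (ln (2 * D) + 2 * h) \<le> exp L" by simp
    then have big: "2 * D * exp (2 * h) \<le> n"
      using D_pos n by (simp add: exp_add L_def)
    have "real m powr (- \<beta>) \<le> (r n / 2) powr (- \<beta>)"
      using m elim(1) \<beta> by (intro powr_mono2') auto
    also have "\<dots> = 2 powr \<beta> * (4 * a) powr (\<beta> / \<alpha>) * (1 / L) powr (\<beta> / \<alpha>)"
      using a \<alpha> L_pos
      by (simp add: r_def L_def powr_powr powr_divide powr_mult powr_minus_divide field_simps)
    \<comment> \<open>The rate \<open>(1 / L) powr (\<beta> / \<alpha>)\<close> is already reached;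
      as \<open>ln L \<ge> 1\<close>, inserting \<open>ln L\<close> only weakens it.\<close>
    also have "\<dots> \<le> 2 powr \<beta> * (4 * a) powr (\<beta> / \<alpha>) * (ln L / L) powr (\<beta> / \<alpha>)"
    proof (intro mult_left_mono powr_mono2)
      have "1 \<le> ln L" using L(1) L_pos by (simp add: ln_ge_iff)
      then show "1 / L \<le> ln L / L" using L_pos by (intro divide_right_mono) auto
    qed (use \<alpha> \<beta> L_pos in auto)
    finally have rate: "8 * (b * real m powr (- \<beta>)) \<le> c * (ln L / L) powr (\<beta> / \<alpha>)"
      using b by (simp add: c_def mult.assoc)
    have "isoperimetric_profile V E n \<le> 8 * TV V E m"
      by (rule isoperimetric_profile_le_TV[OF TV _ h big]) (use N(1)[OF m(1)] in \<open>simp add: h_def\<close>)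
    also have "\<dots> \<le> 8 * (b * real m powr (- \<beta>))" using N(2)[OF m(1)] by simp
    also note rate
    finally have "isoperimetric_profile V E n \<le> c * (ln L / L) powr (\<beta> / \<alpha>)" .
    then show ?case
      using isoperimetric_profile_nonneg[OF n(2)] by (simp add: L_def)
  qed
  then show ?thesis by (rule bigoI)
qed

end
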